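(* Let $G$ be a connected graph. Then $W_\epsilon(G)\geq\frac{\varepsilon^*(G)}{2}$. Equality holds if $G$ is a cycle of even length.
   Context: Graphs are finite, simple, undirected. For a connected graph $G$ with vertices $v_1,\ldots,v_p$, $d(v_i,v_j)$ is the distance and $e(v_i)=\max_j d(v_i,v_j)$ the eccentricity. The eccentricity matrix $\epsilon(G)$ has $(i,j)$ entry $d(v_i,v_j)$ if $d(v_i,v_j)=\min\{e(v_i),e(v_j)\}$ and $0$ otherwise. $W_\epsilon(G)=\frac12\sum_{i,j}(\epsilon(G))_{ij}$ is the eccentricity Wiener index and $\varepsilon^*(G)=\sum_{i=1}^p e(v_i)$ is the total eccentricity. *)

theory Defs
  imports "Graph_Theory.Graph_Theory"
begin

(* The locale predicate graph of the library is the finite simple undirected graph: a finite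
   symmetric digraph without loops and parallel arcs, where an edge uv is the pair of arcs
   (u,v), (v,u). The library predicate connected excludes the null graph. *)

(* Least length of a walk, i.e. the library's shortest-path cost for unit arc weights. The latter
   is an extended real, finite whenever v is reachable from u. *)
definition gdist :: "('a, 'b) pre_digraph \<Rightarrow> 'a \<Rightarrow> 'a \<Rightarrow> real" where
  "gdist G u v = real_of_ereal (wf_digraph.\<mu> G (\<lambda>_. 1) u v)"

definition eccentricity :: "('a, 'b) pre_digraph \<Rightarrow> 'a \<Rightarrow> real" where
  "eccentricity G u = Max (gdist G u ` verts G)"

(* Rows and columns are indexed by the vertices themselves instead of an enumeration of them;
   only the entries with both indices in verts G are meaningful. *)
definition eccentricity_matrix :: "('a, 'b) pre_digraph \<Rightarrow> 'a \<Rightarrow> 'a \<Rightarrow> real" where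
  "eccentricity_matrix G u v =
     (if gdist G u v = min (eccentricity G u) (eccentricity G v) then gdist G u v else 0)"

definition eccentricity_Wiener_index :: "('a, 'b) pre_digraph \<Rightarrow> real" where
  "eccentricity_Wiener_index G =
     1 / 2 * (\<Sum>u\<in>verts G. \<Sum>v\<in>verts G. eccentricity_matrix G u v)"

definition total_eccentricity :: "('a, 'b) pre_digraph \<Rightarrow> real" where
  "total_eccentricity G = (\<Sum>u\<in>verts G. eccentricity G u)"

(* The whole graph G is a cycle on n vertices f 0, ..., f (n - 1), adjacent exactly when cyclically
   consecutive (the library's cycle is a closed walk inside a digraph, and admits u,v,u). *)
definition cycle_graph :: "nat \<Rightarrow> ('a, 'b) pre_digraph \<Rightarrow> bool" where
  "cycle_graph n G \<longleftrightarrow> graph G \<and> n \<ge> 3 \<and>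
     (\<exists>f. bij_betw f {..<n} (verts G) \<and>
        arcs_ends G = (\<Union>i<n. {(f i, f (Suc i mod n)), (f (Suc i mod n), f i)}))"

end

(* If v is a vertex farthest from u, then e(v) >= d(u,v) = e(u), so the entry (u,v) of the
   eccentricity matrix is e(u): every row sum is at least the eccentricity of its vertex. In a
   cycle of even length all eccentricities are equal and every vertex has exactly one farthest
   vertex, its antipode, so each row has a single nonzero entry. *)

theory Submission
  imports Defs
begin

section \<open>Distances as walk lengths, and their symmetry\<close>

lemma (in wf_digraph) awalk_cost_unit: "awalk_cost (\<lambda>_. 1) p = real (length p)"
  by (induction p) auto

text \<open>Unit costs are nonnegative, so some path realises the infimum over all walks; its value
  is then finite and \<open>real_of_ereal\<close> loses nothing.\<close>

lemma (in fin_digraph) gdist_attained: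
  assumes "u \<rightarrow>\<^sup>* v"
  obtains p where "awalk u p v" "gdist G u v = real (length p)"
  using min_cost_awalk[OF assms, of "\<lambda>_. 1"] that
  by (auto simp: gdist_def awalk_cost_unit dest: awalkI_apath)

lemma (in fin_digraph) gdist_le_length:
  assumes "awalk u p v"
  shows "gdist G u v \<le> real (length p)"
proof -
  obtain q where "\<mu> (\<lambda>_. 1) u v = awalk_cost (\<lambda>_. 1) q"
    using min_cost_awalk[OF reachable_awalkI[OF assms], of "\<lambda>_. 1"] by auto
  with min_cost_le_walk_cost[OF assms, of "\<lambda>_. 1"] show ?thesis
    by (simp add: gdist_def awalk_cost_unit)
qed

text \<open>Every arc has an opposite arc, so a walk can be retraced backwards. This is what makes
  distances symmetric.\<close>

lemma (in sym_digraph) awalk_reverse: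
  assumes "awalk u p v"
  shows "\<exists>q. awalk v q u \<and> length q = length p"
  using assms
proof (induction p arbitrary: u)
  case Nil
  then show ?case by (auto simp: awalk_Nil_iff)
next
  case (Cons e p)
  then have e: "e \<in> arcs G" "u = tail G e" and "awalk (head G e) p v"
    by (auto simp: awalk_Cons_iff)
  with Cons.IH obtain q where q: "awalk v q (head G e)" "length q = length p" by blast
  from e sym_arcs obtain e' where "e' \<in> arcs G" "tail G e' = head G e" "head G e' = u"
    unfolding symmetric_conv by metis
  with arc_implies_awalk have "awalk (head G e) [e'] u" by metis
  with q(1) have "awalk v (q @ [e']) u" by (rule awalk_appendI)
  with q(2) show ?case by (intro exI[of _ "q @ [e']"]) simp
qed

lemma (in pseudo_graph) gdist_le_gdist_reverse:
  assumes "u \<rightarrow>\<^sup>* v"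
  shows "gdist G v u \<le> gdist G u v"
proof -
  obtain p where "awalk u p v" "gdist G u v = real (length p)"
    using assms by (rule gdist_attained)
  with awalk_reverse gdist_le_length show ?thesis by metis
qed

lemma (in pseudo_graph) gdist_commute:
  assumes "u \<rightarrow>\<^sup>* v"
  shows "gdist G u v = gdist G v u"
  using gdist_le_gdist_reverse assms symmetric_reachable'[OF assms] by (blast intro: antisym)

section \<open>Eccentricities and the lower bound\<close>

lemma (in fin_digraph) gdist_le_eccentricity:
  "v \<in> verts G \<Longrightarrow> gdist G u v \<le> eccentricity G u"
  by (simp add: eccentricity_def)

lemma (in fin_digraph) eccentricity_attained:
  assumes "verts G \<noteq> {}"
  obtains v where "v \<in> verts G" "eccentricity G u = gdist G u v"
proof -
  have "eccentricity G u \<in> gdist G u ` verts G"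
    unfolding eccentricity_def using assms by (intro Max_in) auto
  with that show ?thesis by auto
qed

lemma (in fin_digraph) gdist_nonneg:
  assumes "u \<rightarrow>\<^sup>* v"
  shows "gdist G u v \<ge> 0"
  using assms by (elim gdist_attained) simp

lemma (in pseudo_graph) eccentricity_le_row_sum:
  assumes "strongly_connected G" "u \<in> verts G"
  shows "eccentricity G u \<le> (\<Sum>v\<in>verts G. eccentricity_matrix G u v)"
proof -
  have reach: "u \<rightarrow>\<^sup>* v" if "v \<in> verts G" for v
    using assms that by auto
  \<comment> \<open>Nonnegativity allows the row sum to be bounded below by a single entry.\<close>
  have nonneg: "eccentricity_matrix G u v \<ge> 0" if "v \<in> verts G" for v
    unfolding eccentricity_matrix_def using gdist_nonneg[OF reach[OF that]] by (metis order_refl)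
  obtain v where v: "v \<in> verts G" "eccentricity G u = gdist G u v"
    using assms(2) eccentricity_attained by blast
  have "eccentricity G u \<le> eccentricity G v"
    using v(2) gdist_commute[OF reach[OF v(1)]] gdist_le_eccentricity[OF assms(2), of v] by simp
  then have "eccentricity G u = eccentricity_matrix G u v"
    using v(2) by (simp add: eccentricity_matrix_def)
  also have "\<dots> \<le> (\<Sum>v\<in>verts G. eccentricity_matrix G u v)"
    using v(1) nonneg by (intro member_le_sum) auto
  finally show ?thesis .
qed

theorem (in pseudo_graph) total_eccentricity_le_Wiener_index:
  assumes "strongly_connected G"
  shows "total_eccentricity G / 2 \<le> eccentricity_Wiener_index G"
  using sum_mono[OF eccentricity_le_row_sum[OF assms], of "verts G"]
  by (simp add: total_eccentricity_def eccentricity_Wiener_index_def)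

section \<open>Equality for cycles of even length\<close>

lemma Wiener_index_eq_of_unique_farthest:
  assumes fin: "finite (verts G)"
    and ecc: "\<And>u. u \<in> verts G \<Longrightarrow> eccentricity G u = m"
    and unique: "\<And>u. u \<in> verts G \<Longrightarrow> \<exists>!v. v \<in> verts G \<and> gdist G u v = m"
  shows "eccentricity_Wiener_index G = total_eccentricity G / 2"
proof -
  have "(\<Sum>v\<in>verts G. eccentricity_matrix G u v) = eccentricity G u" if u: "u \<in> verts G" for u
  proof -
    from unique[OF u] obtain w
      where w: "w \<in> verts G" "\<And>v. v \<in> verts G \<Longrightarrow> gdist G u v = m \<longleftrightarrow> v = w" by metis
    \<comment> \<open>When all eccentricities equal \<open>m\<close>, the minimum in the matrix is
      always \<open>m\<close>, so only the farthest vertex \<open>w\<close> can contribute.\<close>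
    have "(\<Sum>v\<in>verts G. eccentricity_matrix G u v) = (\<Sum>v\<in>verts G. if v = w then m else 0)"
      using u w by (intro sum.cong) (auto simp: eccentricity_matrix_def ecc)
    also have "\<dots> = eccentricity G u"
      using fin u w(1) by (simp add: ecc)
    finally show ?thesis .
  qed
  then show ?thesis
    by (simp add: eccentricity_Wiener_index_def total_eccentricity_def)
qed

text \<open>Serves the upper bounds on cycle distances: there \<open>g\<close> winds periodically
  around the cycle, so walks past the last vertex need no case split.\<close>

lemma (in wf_digraph) awalk_along_sequence:
  assumes "\<And>i. g i \<rightarrow>\<^bsub>G\<^esub> g (Suc i)"
  shows "\<exists>p. awalk (g i) p (g (i + k)) \<and> length p = k"
proof (induction k)
  case 0
  have "g i \<in> verts G" using assms adj_in_verts by blast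
  then show ?case by (auto simp: awalk_Nil_iff)
next
  case (Suc k)
  then obtain p where p: "awalk (g i) p (g (i + k))" "length p = k" by blast
  obtain e where "e \<in> arcs G" "tail G e = g (i + k)" "head G e = g (i + Suc k)"
    using assms[of "i + k"] by auto
  with arc_implies_awalk have "awalk (g (i + k)) [e] (g (i + Suc k))" by metis
  with p(1) have "awalk (g i) (p @ [e]) (g (i + Suc k))" by (rule awalk_appendI)
  with p(2) show ?case by (intro exI[of _ "p @ [e]"]) simp
qed

text \<open>Each arc shifts the index by 1 or -1 modulo \<open>n\<close>, and \<open>s\<close>
  counts forward minus backward steps. This bounds walk lengths, hence distances, from
  below.\<close>

lemma (in wf_digraph) cycle_awalk_displacement:
  assumes ends: "arcs_ends G = (\<Union>i<n. {(f i, f (Suc i mod n)), (f (Suc i mod n), f i)})"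
    and inj: "inj_on f {..<n}"
    and "awalk (f i) p (f j)" "i < n" "j < n"
  shows "\<exists>s. \<bar>s\<bar> \<le> int (length p) \<and> int j mod int n = (int i + s) mod int n"
  using assms(3,4)
proof (induction p arbitrary: i)
  case Nil
  then have "i = j" using inj \<open>j < n\<close> by (auto simp: awalk_Nil_iff inj_on_eq_iff)
  then show ?case by (intro exI[of _ 0]) simp
next
  case (Cons e p)
  then have e: "e \<in> arcs G" "f i = tail G e" and w: "awalk (head G e) p (f j)"
    by (auto simp: awalk_Cons_iff)
  from e have "(f i, head G e) \<in> arcs_ends G" using in_arcs_imp_in_arcs_ends by metis
  then obtain k where k: "k < n"
    and "f i = f k \<and> head G e = f (Suc k mod n) \<or> f i = f (Suc k mod n) \<and> head G e = f k"
    unfolding ends by auto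
  moreover have sk: "Suc k mod n < n" using k by simp
  \<comment> \<open>Injectivity turns equal vertices into equal indices: the first arc goes forward
    from \<open>k\<close> or backward to \<open>k\<close>.\<close>
  ultimately consider "i = k" "head G e = f (Suc k mod n)" | "i = Suc k mod n" "head G e = f k"
    using inj Cons.prems(2) by (auto simp: inj_on_eq_iff)
  then show ?case
  proof cases
    case 1
    with Cons.IH w sk obtain s where s: "\<bar>s\<bar> \<le> int (length p)"
      "int j mod int n = (int (Suc k mod n) + s) mod int n" by metis
    then have "int j mod int n = (int i + (s + 1)) mod int n"
      unfolding of_nat_mod mod_add_left_eq using 1(1) by (simp add: add_ac)
    with s(1) show ?thesis by (intro exI[of _ "s + 1"]) auto
  next
    case 2
    with Cons.IH w k obtain s where s: "\<bar>s\<bar> \<le> int (length p)"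
      "int j mod int n = (int k + s) mod int n" by metis
    then have "int j mod int n = (int i + (s - 1)) mod int n"
      unfolding 2(1) of_nat_mod mod_add_left_eq by simp
    with s(1) show ?thesis by (intro exI[of _ "s - 1"]) auto
  qed
qed

text \<open>The two ways round the cycle have lengths adding up to \<open>2 * m\<close>, so the
  shorter is at most \<open>m\<close>, with equality only for antipodes. Conversely, a walk to the
  antipode has an odd multiple of \<open>m\<close> as displacement, so it is not shorter than
  \<open>m\<close>.\<close>

lemma (in graph) even_cycle_gdist:
  assumes ends: "arcs_ends G = (\<Union>i<n. {(f i, f (Suc i mod n)), (f (Suc i mod n), f i)})"
    and bij: "bij_betw f {..<n} (verts G)"
    and n: "n = 2 * m" and ij: "i < n" "j < n"
  shows "gdist G (f i) (f j) \<le> real m"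
    and "gdist G (f i) (f j) = real m \<longleftrightarrow> j = (i + m) mod n"
proof -
  have "n > 0" using ij by simp
  define g where "g k = f (k mod n)" for k
  have "g k \<rightarrow>\<^bsub>G\<^esub> g (Suc k)" for k
    unfolding ends g_def using \<open>n > 0\<close> by (auto simp: mod_Suc_eq intro!: bexI[of _ "k mod n"])
  note walk = awalk_along_sequence[of g, OF this]
  have upper: "gdist G (g a) (g (a + k)) \<le> real k" for a k
    using walk[of a k] gdist_le_length by blast
  have reach: "f i \<rightarrow>\<^sup>* f j"
  proof -
    \<comment> \<open>Adding \<open>n\<close> keeps the natural subtraction from truncating when
      \<open>j < i\<close>; the endpoint index \<open>j + n\<close> reduces to
      \<open>j\<close>.\<close>
    have "g i \<rightarrow>\<^sup>* g (i + (j + n - i))" using walk reachable_awalkI by blast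
    then show ?thesis using ij by (simp add: g_def)
  qed
  \<comment> \<open>The number of forward steps from \<open>i\<close> to \<open>j\<close>.\<close>
  define k where "k = (j + n - i) mod n"
  have "k < n" using \<open>n > 0\<close> by (simp add: k_def)
  have j: "j = (i + k) mod n"
    unfolding k_def mod_add_right_eq using ij by simp
  \<comment> \<open>Going on forward from \<open>j\<close> closes the cycle; by symmetry of the
    distance this also bounds the way from \<open>i\<close> to \<open>j\<close>.\<close>
  have i: "i = (j + (n - k)) mod n"
  proof -
    have "(j + (n - k)) mod n = (i + k + (n - k)) mod n" unfolding j by (simp add: mod_simps)
    then show ?thesis using \<open>k < n\<close> ij by simp
  qed
  have le1: "gdist G (f i) (f j) \<le> real k"
    using upper[of i k] j ij by (simp add: g_def)
  have le2: "gdist G (f i) (f j) \<le> real (n - k)"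
    using upper[of j "n - k"] i ij gdist_commute[OF reach] by (simp add: g_def)
  show "gdist G (f i) (f j) \<le> real m"
    using le1 le2 n by linarith
  show "gdist G (f i) (f j) = real m \<longleftrightarrow> j = (i + m) mod n"
  proof
    assume "gdist G (f i) (f j) = real m"
    \<comment> \<open>Both \<open>k\<close> and \<open>n - k\<close> are at least \<open>m\<close>
      and their sum is \<open>2 * m\<close>.\<close>
    with le1 le2 n \<open>k < n\<close> have "k = m" by simp
    with j show "j = (i + m) mod n" by simp
  next
    assume jm: "j = (i + m) mod n"
    obtain p where p: "awalk (f i) p (f j)" "gdist G (f i) (f j) = real (length p)"
      using reach by (rule gdist_attained)
    obtain s where s: "\<bar>s\<bar> \<le> int (length p)" "int j mod int n = (int i + s) mod int n"
      using cycle_awalk_displacement[OF ends bij_betw_imp_inj_on[OF bij] p(1) ij] by blast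
    have "(int i + int m) mod int n = (int i + s) mod int n"
      using s(2) jm by (simp add: zmod_int)
    then have "int n dvd int m - s"
      by (metis mod_eq_dvd_iff add_diff_cancel_left)
    then obtain t where t: "int m - s = int n * t" by blast
    \<comment> \<open>The factor is odd, hence nonzero, which forces the absolute value of
      \<open>s\<close> up to at least \<open>m\<close>.\<close>
    have "s = int m * (1 - 2 * t)" using t n by (simp add: algebra_simps)
    then have "\<bar>s\<bar> = int m * \<bar>1 - 2 * t\<bar>" by (simp add: abs_mult)
    moreover have "\<bar>1 - 2 * t\<bar> \<ge> 1" by presburger
    ultimately have "\<bar>s\<bar> \<ge> int m" using mult_left_mono[of 1 "\<bar>1 - 2 * t\<bar>" "int m"] by simp
    with s(1) p(2) have "gdist G (f i) (f j) \<ge> real m" by linarith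
    with \<open>gdist G (f i) (f j) \<le> real m\<close> show "gdist G (f i) (f j) = real m" by simp
  qed
qed

theorem even_cycle_Wiener_index:
  assumes "even n" "cycle_graph n G"
  shows "eccentricity_Wiener_index G = total_eccentricity G / 2"
proof -
  interpret graph G using assms(2) by (simp add: cycle_graph_def)
  obtain f where bij: "bij_betw f {..<n} (verts G)"
    and ends: "arcs_ends G = (\<Union>i<n. {(f i, f (Suc i mod n)), (f (Suc i mod n), f i)})"
    using assms(2) by (auto simp: cycle_graph_def)
  obtain m where n: "n = 2 * m" using assms(1) by blast
  note dist = even_cycle_gdist[OF ends bij n]
  have V: "verts G = f ` {..<n}" using bij by (simp add: bij_betw_def)
  have unique: "\<exists>!v. v \<in> verts G \<and> gdist G u v = real m" if "u \<in> verts G" for u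
  proof -
    from that obtain i where i: "i < n" "u = f i" unfolding V by blast
    then have "(i + m) mod n < n" by simp
    with i V dist show ?thesis by (intro ex1I[of _ "f ((i + m) mod n)"]) auto
  qed
  have ecc: "eccentricity G u = real m" if u: "u \<in> verts G" for u
  proof (rule antisym)
    obtain v where v: "v \<in> verts G" "eccentricity G u = gdist G u v"
      using u eccentricity_attained by blast
    with u V dist(1) show "eccentricity G u \<le> real m" by auto
    \<comment> \<open>The antipode lies at distance exactly \<open>m\<close>.\<close>
    show "real m \<le> eccentricity G u" using unique[OF u] gdist_le_eccentricity by metis
  qed
  show ?thesis
    using finite_verts ecc unique by (rule Wiener_index_eq_of_unique_farthest)
qed

theorem theorem4p4:
  fixes G :: "('a, 'b) pre_digraph"
  assumes "graph G"
    and "Digraph_Component.connected G"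
  shows "eccentricity_Wiener_index G \<ge> total_eccentricity G / 2 \<and>
    (\<forall>n. even n \<and> cycle_graph n G \<longrightarrow> eccentricity_Wiener_index G = total_eccentricity G / 2)"
proof -
  interpret graph G by fact
  \<comment> \<open>\<open>connected\<close> speaks of the symmetrised digraph; since the arcs are
    already symmetric, it yields reachability in \<open>G\<close> itself.\<close>
  have "strongly_connected G"
    using sym_arcs assms(2) by (rule symmetric_connected_imp_strongly_connected)
  then show ?thesis
    using total_eccentricity_le_Wiener_index even_cycle_Wiener_index by blast
qed

end
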